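(* Let $p,q$ be positive integers with $p\ge q$. For every tree $T$ of order $n$ (with $n\ge 2$), we have $$n\le a(p,q;T)\le n+q\left\lfloor \frac{n-2}{p}\right\rfloor .$$
   Context: For integers $p\ge q\ge 1$ and a finite graph $G$ with no isolated vertices, the $(p,q)$-achievement game of $G$ on the complete graph $K_N$ is played by two players, Alice and Bob, on the edges of $K_N$, all initially uncolored. In each round, Alice first chooses $p$ uncolored edges and colors them blue, then Bob chooses $q$ uncolored edges and colors them red. The player who first completes a copy of $G$ (a subgraph isomorphic to $G$) all of whose edges are in his or her own color wins; if neither does, the game is a draw. The $(p,q)$-achievement number $a(p,q;G)$ is the smallest $N$ for which Alice has a winning strategy in this game on $K_N$. *)

theory Defs
  imports Main "HOL-Library.Extended_Nat" "HOL-Library.Ramsey"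
begin

record 'a ugraph =
  verts :: "'a set"
  edges :: "'a set set"

definition finite_simple_graph :: "'a ugraph \<Rightarrow> bool" where
  "finite_simple_graph G \<longleftrightarrow> finite (verts G) \<and> edges G \<subseteq> [verts G]\<^bsup>2\<^esup>"

definition connected_graph :: "'a ugraph \<Rightarrow> bool" where
  "connected_graph G \<longleftrightarrow> verts G \<noteq> {} \<and>
     (\<forall>u \<in> verts G. \<forall>v \<in> verts G. (u, v) \<in> {(x, y). {x, y} \<in> edges G}\<^sup>*)"

definition is_cycle :: "'a ugraph \<Rightarrow> 'a list \<Rightarrow> bool" where
  "is_cycle G xs \<longleftrightarrow> length xs \<ge> 3 \<and> distinct xs \<and>
     (\<forall>i < length xs. {xs ! i, xs ! (Suc i mod length xs)} \<in> edges G)"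

definition is_tree :: "'a ugraph \<Rightarrow> bool" where
  "is_tree G \<longleftrightarrow> finite_simple_graph G \<and> connected_graph G \<and> (\<nexists>xs. is_cycle G xs)"

definition complete_graph :: "nat \<Rightarrow> nat ugraph" where
  "complete_graph N = \<lparr>verts = {..<N}, edges = [{..<N}]\<^bsup>2\<^esup>\<rparr>"

definition subgraph :: "'a ugraph \<Rightarrow> 'a ugraph \<Rightarrow> bool" where
  "subgraph H G \<longleftrightarrow> verts H \<subseteq> verts G \<and> edges H \<subseteq> edges G \<and> edges H \<subseteq> [verts H]\<^bsup>2\<^esup>"

definition graph_iso :: "'a ugraph \<Rightarrow> 'b ugraph \<Rightarrow> bool" where
  "graph_iso G H \<longleftrightarrow> (\<exists>f. bij_betw f (verts G) (verts H) \<and> edges H = (\<lambda>e. f ` e) ` edges G)"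

definition has_copy :: "'a ugraph \<Rightarrow> nat \<Rightarrow> nat set set \<Rightarrow> bool" where
  "has_copy G N C \<longleftrightarrow> (\<exists>H. subgraph H (complete_graph N) \<and> edges H \<subseteq> C \<and> graph_iso G H)"

text \<open>
  A player who has to color \<open>k\<close> edges when fewer than \<open>k\<close> are uncolored colors all of the
  remaining ones. Hence a play can be modelled as infinite: once every edge is colored, all
  moves are empty.
\<close>

definition legal_move :: "nat \<Rightarrow> nat \<Rightarrow> nat set set \<Rightarrow> nat set set \<Rightarrow> bool" where
  "legal_move N k colored M \<longleftrightarrow>
     M \<subseteq> edges (complete_graph N) - colored \<and>
     card M = min k (card (edges (complete_graph N) - colored))"

text \<open>
  In a play \<open>(A, B)\<close>, Alice makes the move \<open>A t\<close> and then Bob the move \<open>B t\<close> in round \<open>t\<close>,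
  where rounds are counted from \<open>0\<close>.
\<close>

definition colored_before :: "(nat \<Rightarrow> nat set set) \<Rightarrow> nat \<Rightarrow> nat set set" where
  "colored_before M t = (\<Union>s<t. M s)"

definition alice_legal :: "nat \<Rightarrow> nat \<Rightarrow> (nat \<Rightarrow> nat set set) \<Rightarrow> (nat \<Rightarrow> nat set set) \<Rightarrow> bool" where
  "alice_legal p N A B \<longleftrightarrow>
     (\<forall>t. legal_move N p (colored_before A t \<union> colored_before B t) (A t))"

definition bob_legal :: "nat \<Rightarrow> nat \<Rightarrow> (nat \<Rightarrow> nat set set) \<Rightarrow> (nat \<Rightarrow> nat set set) \<Rightarrow> bool" where
  "bob_legal q N A B \<longleftrightarrow>
     (\<forall>t. legal_move N q (colored_before A (Suc t) \<union> colored_before B t) (B t))"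

text \<open>
  Alice wins if, after her move in some round \<open>t\<close>, she has a blue copy of \<open>G\<close> while Bob had not
  completed a red one in an earlier round. Moves made after the game has been decided
  do not affect this.
\<close>

definition alice_wins :: "'a ugraph \<Rightarrow> nat \<Rightarrow> (nat \<Rightarrow> nat set set) \<Rightarrow> (nat \<Rightarrow> nat set set) \<Rightarrow> bool" where
  "alice_wins G N A B \<longleftrightarrow>
     (\<exists>t. has_copy G N (colored_before A (Suc t)) \<and> \<not> has_copy G N (colored_before B t))"

text \<open>A strategy for Alice maps the list of completed rounds to her next move.\<close>

type_synonym strategy = "(nat set set \<times> nat set set) list \<Rightarrow> nat set set"

definition follows :: "strategy \<Rightarrow> (nat \<Rightarrow> nat set set) \<Rightarrow> (nat \<Rightarrow> nat set set) \<Rightarrow> bool" where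
  "follows \<sigma> A B \<longleftrightarrow> (\<forall>t. A t = \<sigma> (map (\<lambda>s. (A s, B s)) [0..<t]))"

text \<open>
  Legality of Alice's moves is part of the conclusion, so that a strategy prescribing illegal
  moves is not vacuously winning.
\<close>

definition winning_strategy :: "nat \<Rightarrow> nat \<Rightarrow> 'a ugraph \<Rightarrow> nat \<Rightarrow> strategy \<Rightarrow> bool" where
  "winning_strategy p q G N \<sigma> \<longleftrightarrow>
     (\<forall>A B. follows \<sigma> A B \<and> bob_legal q N A B \<longrightarrow> alice_legal p N A B \<and> alice_wins G N A B)"

text \<open>The value is \<open>\<infinity>\<close> if Alice has a winning strategy on no complete graph.\<close>

definition achievement_number :: "nat \<Rightarrow> nat \<Rightarrow> 'a ugraph \<Rightarrow> enat" where
  "achievement_number p q G = Inf {enat N | N. \<exists>\<sigma>. winning_strategy p q G N \<sigma>}"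

end

theory Submission
  imports Defs
begin

text \<open>
  Alice embeds \<open>T\<close> greedily, one leaf at a time, \<open>p\<close> leaves per round. Put
  \<open>k = (n - 2) div p\<close>. Until the end of her move in round \<open>k\<close> Bob owns at most \<open>q * k\<close> edges,
  while at least \<open>q * k + 1\<close> vertices lie outside a blue copy of a proper subtree; hence at every
  vertex of the copy some edge leaving it is still uncolored. After this move the copy is complete,
  and Bob has not won before, since \<open>q * k \<le> p * k < n - 1\<close>.
\<close>

section \<open>Growing subtrees of a tree\<close>

text \<open>Connectivity in \<open>connected_graph\<close> speaks of walks in the whole graph. Here
  paths repeat no vertex and stay inside \<open>S\<close>, so that a vertex outside \<open>S\<close>
  can close them to a cycle.\<close>

definition simple_path :: "'a ugraph \<Rightarrow> 'a set \<Rightarrow> 'a \<Rightarrow> 'a \<Rightarrow> 'a list \<Rightarrow> bool" where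
  "simple_path G S y z xs \<longleftrightarrow> xs \<noteq> [] \<and> hd xs = y \<and> last xs = z \<and> distinct xs \<and> set xs \<subseteq> S \<and>
     successively (\<lambda>a b. {a, b} \<in> edges G) xs"

definition path_connected :: "'a ugraph \<Rightarrow> 'a set \<Rightarrow> bool" where
  "path_connected G S \<longleftrightarrow> S \<subseteq> verts G \<and> (\<forall>y\<in>S. \<forall>z\<in>S. \<exists>xs. simple_path G S y z xs)"

definition induced_edges :: "'a ugraph \<Rightarrow> 'a set \<Rightarrow> 'a set set" where
  "induced_edges G S = {e \<in> edges G. e \<subseteq> S}"

text \<open>Used in contrapositive form: in an acyclic graph a vertex outside a path-connected set
  has at most one neighbour in it.\<close>

lemma simple_path_close_cycle:
  assumes "simple_path G S y z xs" "y \<noteq> z" "x \<notin> S" "{x, y} \<in> edges G" "{x, z} \<in> edges G"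
  shows "is_cycle G (x # xs)"
proof -
  have ne: "xs \<noteq> []" and hd: "hd xs = y" and la: "last xs = z" and d: "distinct xs"
    and s: "set xs \<subseteq> S" and su: "successively (\<lambda>a b. {a, b} \<in> edges G) xs"
    using assms(1) by (auto simp: simple_path_def)
  \<comment> \<open>Since \<open>y\<close> and \<open>z\<close> differ, the path has two vertices,
    and \<open>x\<close> is the third that \<open>is_cycle\<close> requires.\<close>
  have len: "length xs \<ge> 2"
    using ne hd la assms(2) by (cases xs; cases "tl xs") auto
  have step: "{xs ! i, xs ! Suc i} \<in> edges G" if "Suc i < length xs" for i
    using su that
  proof (induction xs arbitrary: i)
    case (Cons a ys)
    then show ?case by (cases i) (auto simp: successively_Cons hd_conv_nth)
  qed simp
  have "{(x # xs) ! i, (x # xs) ! (Suc i mod length (x # xs))} \<in> edges G"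
    if i: "i < length (x # xs)" for i
  proof (cases "i = length xs")
    \<comment> \<open>The index wraps around here: the closing edge runs from \<open>z\<close> back
      to \<open>x\<close>.\<close>
    case True
    have "(x # xs) ! i = z" using True ne la by (simp add: last_conv_nth nth_Cons')
    then show ?thesis using True assms(5) by (simp add: insert_commute)
  next
    case False
    with i have lt: "i < length xs" by simp
    show ?thesis
    proof (cases i)
      case 0
      then show ?thesis using lt hd assms(4) by (simp add: hd_conv_nth[OF ne])
    next
      case (Suc j)
      then show ?thesis using lt step[of j] by simp
    qed
  qed
  moreover have "distinct (x # xs)" using d s assms(3) by auto
  ultimately show ?thesis using len unfolding is_cycle_def by simp
qed

lemma path_connected_insert:
  assumes pc: "path_connected G S" and y: "y \<in> S" and x: "x \<in> verts G" "x \<notin> S"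
    and e: "{y, x} \<in> edges G"
  shows "path_connected G (insert x S)"
proof -
  have S: "S \<subseteq> verts G" and path: "\<And>a b. a \<in> S \<Longrightarrow> b \<in> S \<Longrightarrow> \<exists>xs. simple_path G S a b xs"
    using pc by (auto simp: path_connected_def)
  have "\<exists>xs. simple_path G (insert x S) a b xs" if ab: "a \<in> insert x S" "b \<in> insert x S" for a b
  proof -
    consider "a = x" "b = x" | "a = x" "b \<in> S" | "a \<in> S" "b = x" | "a \<in> S" "b \<in> S"
      using ab by blast
    then show ?thesis
    proof cases
      case 1
      then have "simple_path G (insert x S) a b [x]" by (simp add: simple_path_def)
      then show ?thesis ..
    next
      case 2
      obtain xs where "simple_path G S y b xs" using path y 2 by blast
      then have "simple_path G (insert x S) a b (x # xs)"
        using 2 x e by (auto simp: simple_path_def successively_Cons insert_commute)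
      then show ?thesis ..
    next
      case 3
      obtain xs where "simple_path G S a y xs" using path y 3 by blast
      then have "simple_path G (insert x S) a b (xs @ [x])"
        using 3 x e by (auto simp: simple_path_def successively_append_iff)
      then show ?thesis ..
    next
      case 4
      obtain xs where "simple_path G S a b xs" using path 4 by blast
      then have "simple_path G (insert x S) a b xs" by (auto simp: simple_path_def)
      then show ?thesis ..
    qed
  qed
  then show ?thesis using S x by (simp add: path_connected_def)
qed

lemma connected_graph_leaving_edge:
  assumes "connected_graph G" "edges G \<subseteq> [verts G]\<^bsup>2\<^esup>" "S \<subseteq> verts G" "S \<noteq> {}" "S \<noteq> verts G"
  obtains x y where "y \<in> S" "x \<in> verts G" "x \<notin> S" "{y, x} \<in> edges G"
proof -
  obtain u v where u: "u \<in> S" and v: "v \<in> verts G" "v \<notin> S" using assms by blast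
  have "(u, v) \<in> {(x, y). {x, y} \<in> edges G}\<^sup>*"
    using assms(1,3) u v unfolding connected_graph_def by blast
  \<comment> \<open>Along the walk from \<open>u\<close>, either the current end is still in
    \<open>S\<close> or an edge leaving \<open>S\<close> has already been met.\<close>
  then have "v \<in> S \<or> (\<exists>y x. y \<in> S \<and> x \<notin> S \<and> {y, x} \<in> edges G)"
    by (induction rule: rtrancl_induct) (use u in auto)
  then obtain y x where "y \<in> S" "x \<notin> S" "{y, x} \<in> edges G" using v by blast
  then show thesis using that assms(2) by fastforce
qed

text \<open>Connectivity supplies an edge leaving \<open>S\<close>; acyclicity makes it the only
  edge between its outer end \<open>x\<close> and \<open>S\<close>. So each new vertex of a growing
  subtree costs exactly one edge.\<close>

lemma is_tree_extend:
  assumes T: "is_tree T" and S: "path_connected T S" "S \<noteq> {}" "S \<noteq> verts T"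
  obtains x y where "y \<in> S" "x \<in> verts T" "x \<notin> S" "path_connected T (insert x S)"
    "induced_edges T (insert x S) = insert {y, x} (induced_edges T S)"
proof -
  have E: "edges T \<subseteq> [verts T]\<^bsup>2\<^esup>" and con: "connected_graph T" and acyc: "\<nexists>xs. is_cycle T xs"
    using T by (auto simp: is_tree_def finite_simple_graph_def)
  have sub: "S \<subseteq> verts T" using S by (simp add: path_connected_def)
  obtain x y where xy: "y \<in> S" "x \<in> verts T" "x \<notin> S" "{y, x} \<in> edges T"
    using connected_graph_leaving_edge[OF con E sub S(2,3)] .
  have unique: "z = y" if z: "z \<in> S" "{z, x} \<in> edges T" for z
  proof (rule ccontr)
    assume "z \<noteq> y"
    obtain xs where path: "simple_path T S z y xs"
      using S(1) z(1) xy(1) unfolding path_connected_def by blast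
    have "{x, z} \<in> edges T" "{x, y} \<in> edges T"
      using z(2) xy(4) by (simp_all only: insert_commute[of x])
    with simple_path_close_cycle[OF path \<open>z \<noteq> y\<close> xy(3)] acyc show False by simp
  qed
  have "e = {y, x}" if e: "e \<in> edges T" "e \<subseteq> insert x S" "\<not> e \<subseteq> S" for e
  proof -
    obtain a b where ab: "e = {a, b}" "a \<noteq> b" using e(1) E by (metis nsets2_E subsetD)
    then consider "a = x" "b \<in> S" | "b = x" "a \<in> S" using e(2,3) unfolding ab(1) by blast
    then show ?thesis
    proof cases
      case 1
      then have "e = {b, x}" using ab(1) by (simp add: insert_commute)
      then show ?thesis using unique[of b] 1 e(1) by simp
    next
      case 2
      then show ?thesis using unique[of a] ab(1) e(1) by simp
    qed
  qed
  moreover have "{y, x} \<subseteq> insert x S" using xy(1) by simp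
  ultimately have "induced_edges T (insert x S) = insert {y, x} (induced_edges T S)"
    unfolding induced_edges_def using xy(4) by blast
  then show thesis using that[OF xy(1-3) path_connected_insert[OF S(1) xy]] by simp
qed

lemma path_connected_singleton: "v \<in> verts G \<Longrightarrow> path_connected G {v}"
  by (auto simp: path_connected_def simple_path_def intro!: exI[of _ "[v]"])

lemma induced_edges_singleton:
  assumes "edges G \<subseteq> [verts G]\<^bsup>2\<^esup>"
  shows "induced_edges G {v} = {}"
  using assms by (fastforce simp: induced_edges_def nsets_2_eq)

lemma induced_edges_verts:
  assumes "edges G \<subseteq> [verts G]\<^bsup>2\<^esup>"
  shows "induced_edges G (verts G) = edges G"
  using assms by (auto simp: induced_edges_def nsets_def)

lemma finite_edges:
  assumes "finite_simple_graph G"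
  shows "finite (edges G)"
  using assms finite_imp_finite_nsets finite_subset unfolding finite_simple_graph_def by blast

text \<open>Growing from a single vertex by \<open>is_tree_extend\<close> adds one vertex and one
  edge at each step. The count later shows that Bob owns too few edges for a copy.\<close>

lemma card_edges_tree:
  assumes T: "is_tree T"
  shows "Suc (card (edges T)) = card (verts T)"
proof -
  have E: "edges T \<subseteq> [verts T]\<^bsup>2\<^esup>" and finV: "finite (verts T)" and finE: "finite (edges T)"
    and con: "connected_graph T"
    using T finite_edges by (auto simp: is_tree_def finite_simple_graph_def)
  obtain v where v: "v \<in> verts T" using con by (auto simp: connected_graph_def)
  have "\<exists>S. path_connected T S \<and> card S = Suc j \<and> card (induced_edges T S) = j"
    if "j < card (verts T)" for j
    using that
  proof (induction j)
    case 0
    then show ?case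
      using path_connected_singleton[OF v] induced_edges_singleton[OF E]
      by (intro exI[of _ "{v}"]) simp
  next
    case (Suc j)
    then obtain S where S: "path_connected T S" "card S = Suc j" "card (induced_edges T S) = j"
      by auto
    then have "S \<noteq> {}" "S \<noteq> verts T" using Suc.prems by auto
    then obtain x y where xy: "y \<in> S" "x \<in> verts T" "x \<notin> S" "path_connected T (insert x S)"
      "induced_edges T (insert x S) = insert {y, x} (induced_edges T S)"
      using is_tree_extend[OF T S(1)] by metis
    have "{y, x} \<notin> induced_edges T S" using xy(3) by (auto simp: induced_edges_def)
    moreover have "finite (induced_edges T S)" using finE by (simp add: induced_edges_def)
    moreover have "finite S" using S(2) card_ge_0_finite by force
    ultimately show ?case using S xy by (intro exI[of _ "insert x S"]) simp
  qed
  moreover have pos: "card (verts T) > 0" using v finV by (auto simp: card_gt_0_iff)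
  ultimately obtain S where S: "path_connected T S" "card S = Suc (card (verts T) - 1)"
    "card (induced_edges T S) = card (verts T) - 1"
    by (metis diff_less zero_less_one)
  then have "S = verts T"
    using pos finV by (intro card_subset_eq) (auto simp: path_connected_def)
  then show ?thesis using S pos induced_edges_verts[OF E] by simp
qed

section \<open>Copies in the complete graph\<close>

lemma finite_edges_complete_graph: "finite (edges (complete_graph N))"
  by (simp add: complete_graph_def finite_imp_finite_nsets)

lemma has_copy_mono: "has_copy G N C \<Longrightarrow> C \<subseteq> D \<Longrightarrow> has_copy G N D"
  unfolding has_copy_def by blast

lemma has_copy_card_verts:
  assumes "has_copy G N C"
  shows "card (verts G) \<le> N"
proof -
  obtain H where "subgraph H (complete_graph N)" "graph_iso G H"
    using assms unfolding has_copy_def by blast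
  then obtain f where "verts H \<subseteq> {..<N}" "bij_betw f (verts G) (verts H)"
    unfolding subgraph_def graph_iso_def complete_graph_def by auto
  then show ?thesis
    using bij_betw_same_card[of f "verts G" "verts H"] card_mono[of "{..<N}" "verts H"] by simp
qed

text \<open>The bijection on vertices is injective on sets of vertices too, so distinct edges of
  \<open>G\<close> need distinct edges of \<open>C\<close>.\<close>

lemma has_copy_card_edges:
  assumes "has_copy G N C" "edges G \<subseteq> [verts G]\<^bsup>2\<^esup>" "finite C"
  shows "card (edges G) \<le> card C"
proof -
  obtain H where "edges H \<subseteq> C" "graph_iso G H" using assms(1) unfolding has_copy_def by blast
  then obtain f where H: "edges H \<subseteq> C" "bij_betw f (verts G) (verts H)"
    "edges H = (\<lambda>e. f ` e) ` edges G"
    unfolding graph_iso_def by (elim exE conjE)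
  have "edges G \<subseteq> Pow (verts G)" using assms(2) by (auto simp: nsets_def)
  then have "inj_on (\<lambda>e. f ` e) (edges G)"
    using inj_on_image_Pow H(2) inj_on_subset unfolding bij_betw_def by blast
  then have "card (edges G) = card (edges H)" using H(3) by (simp add: card_image)
  also have "\<dots> \<le> card C" using assms(3) H(1) by (rule card_mono)
  finally show ?thesis .
qed

lemma image_edges_complete_graph:
  assumes "e \<in> [S]\<^bsup>2\<^esup>" "inj_on f S" "f ` S \<subseteq> {..<N}"
  shows "f ` e \<in> edges (complete_graph N)"
proof -
  obtain x y where "e = {x, y}" "x \<in> S" "y \<in> S" "x \<noteq> y" using assms(1) by (rule nsets2_E)
  then show ?thesis using assms(2,3) by (auto simp: complete_graph_def inj_on_eq_iff)
qed

lemma has_copy_image: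
  assumes "edges G \<subseteq> [verts G]\<^bsup>2\<^esup>" "inj_on f (verts G)" "f ` verts G \<subseteq> {..<N}"
    "(\<lambda>e. f ` e) ` edges G \<subseteq> C"
  shows "has_copy G N C"
proof -
  let ?H = "\<lparr>verts = f ` verts G, edges = (\<lambda>e. f ` e) ` edges G\<rparr>"
  have "f ` e \<in> [f ` verts G]\<^bsup>2\<^esup>" if "e \<in> edges G" for e
    using that assms(1,2) by (auto elim!: nsets2_E dest: inj_onD dest!: subsetD)
  moreover have "(\<lambda>e. f ` e) ` edges G \<subseteq> edges (complete_graph N)"
    using image_edges_complete_graph[of _ "verts G" f N] assms(1-3) by blast
  ultimately have "subgraph ?H (complete_graph N)"
    using assms(3) by (auto simp: subgraph_def complete_graph_def)
  moreover have "graph_iso G ?H"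
    using assms(2) by (auto simp: graph_iso_def bij_betw_def)
  ultimately show ?thesis
    unfolding has_copy_def using assms(4) by (intro exI[of _ ?H]) simp
qed

section \<open>Growing a blue copy of a subtree\<close>

text \<open>The equation for \<open>C\<close>, rather than an inclusion, ensures that no blue edge
  leaves the copy; hence only red edges can block a new leaf.\<close>

definition blue_subtree :: "'a ugraph \<Rightarrow> nat \<Rightarrow> nat \<Rightarrow> nat set set \<Rightarrow> bool" where
  "blue_subtree T N m C \<longleftrightarrow> (\<exists>S f. path_connected T S \<and> card S = m \<and> inj_on f S \<and>
     f ` S \<subseteq> {..<N} \<and> C = (\<lambda>e. f ` e) ` induced_edges T S)"

lemma blue_subtree_has_copy:
  assumes "is_tree T" "blue_subtree T N (card (verts T)) C"
  shows "has_copy T N C"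
proof -
  have E: "edges T \<subseteq> [verts T]\<^bsup>2\<^esup>" and fin: "finite (verts T)"
    using assms(1) by (auto simp: is_tree_def finite_simple_graph_def)
  obtain S f where S: "path_connected T S" "card S = card (verts T)" "inj_on f S"
    "f ` S \<subseteq> {..<N}" "C = (\<lambda>e. f ` e) ` induced_edges T S"
    using assms(2) unfolding blue_subtree_def by blast
  moreover have "S = verts T"
    using S(1,2) fin by (intro card_subset_eq) (auto simp: path_connected_def)
  ultimately show ?thesis
    using has_copy_image[OF E] by (simp add: induced_edges_verts[OF E])
qed

lemma blue_subtree_subset:
  assumes "is_tree T" "blue_subtree T N m C"
  shows "C \<subseteq> edges (complete_graph N)"
proof -
  have E: "edges T \<subseteq> [verts T]\<^bsup>2\<^esup>"
    using assms(1) by (auto simp: is_tree_def finite_simple_graph_def)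
  obtain S f where "inj_on f S" "f ` S \<subseteq> {..<N}" and C: "C = (\<lambda>e. f ` e) ` induced_edges T S"
    using assms(2) unfolding blue_subtree_def by blast
  moreover have "e \<in> [S]\<^bsup>2\<^esup>" if "e \<in> induced_edges T S" for e
    using that E by (auto simp: induced_edges_def nsets_def)
  ultimately show ?thesis using image_edges_complete_graph by blast
qed

text \<open>
  The bound on \<open>card D\<close> leaves a free vertex \<open>w\<close> for the new leaf: the red edges block at most
  \<open>card D\<close> of the \<open>N - m\<close> vertices outside the blue copy.
\<close>

lemma blue_subtree_extend:
  assumes T: "is_tree T" and C: "blue_subtree T N m C" and m: "0 < m" "m < card (verts T)"
    and D: "finite D" "m + card D < N"
  obtains e where "e \<notin> C" "e \<notin> D" "blue_subtree T N (Suc m) (insert e C)"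
proof -
  obtain S f where S: "path_connected T S" "card S = m" "inj_on f S" "f ` S \<subseteq> {..<N}"
    and C_eq: "C = (\<lambda>e. f ` e) ` induced_edges T S"
    using C unfolding blue_subtree_def by blast
  have finS: "finite S" using S(2) m(1) card_ge_0_finite by blast
  have "S \<noteq> {}" "S \<noteq> verts T" using S(2) m by auto
  then obtain x y where xy: "y \<in> S" "x \<in> verts T" "x \<notin> S" "path_connected T (insert x S)"
    "induced_edges T (insert x S) = insert {y, x} (induced_edges T S)"
    using is_tree_extend[OF T S(1)] by metis
  \<comment> \<open>The vertices whose edge to \<open>f y\<close> is red. Distinct ones give
    distinct edges of \<open>D\<close>, so there are at most \<open>card D\<close> of them.\<close>
  let ?B = "{w. {f y, w} \<in> D}"
  have inj: "inj_on (\<lambda>w. {f y, w}) ?B" by (auto simp: inj_on_def doubleton_eq_iff)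
  have cardB: "card ?B \<le> card D" by (rule card_inj_on_le[OF inj]) (use D in auto)
  have finB: "finite ?B"
    by (rule inj_on_finite[OF inj _ D(1)]) auto
  have "card (f ` S \<union> ?B) \<le> m + card D"
    using card_Un_le[of "f ` S" ?B] cardB S(2) card_image_le[OF finS, of f] by linarith
  then have "\<not> {..<N} \<subseteq> f ` S \<union> ?B"
    using card_mono[of "f ` S \<union> ?B" "{..<N}"] finS finB D(2) by auto
  then obtain w where w: "w < N" "w \<notin> f ` S" "{f y, w} \<notin> D" by auto
  let ?g = "f(x := w)"
    have img: "?g ` e = f ` e" if "e \<subseteq> S" for e using that xy(3) by (intro image_cong) auto
  have "inj_on ?g (insert x S)"
    using S(3) w(2) xy(3) by (auto simp: inj_on_def)
  moreover have "?g ` insert x S \<subseteq> {..<N}" using S(4) w(1) by auto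
  moreover have "(\<lambda>e. ?g ` e) ` induced_edges T S = C"
    unfolding C_eq by (rule image_cong) (use img in \<open>auto simp: induced_edges_def\<close>)
  then have "insert {f y, w} C = (\<lambda>e. ?g ` e) ` induced_edges T (insert x S)"
    using xy(1,3) by (auto simp: xy(5))
  moreover have "card (insert x S) = Suc m" using finS S(2) xy(3) by simp
  ultimately have "blue_subtree T N (Suc m) (insert {f y, w} C)"
    unfolding blue_subtree_def using xy(4) by (intro exI[of _ "insert x S"] exI[of _ ?g]) simp
  \<comment> \<open>Every edge of \<open>C\<close> lies inside the image of \<open>S\<close>, which
    misses \<open>w\<close>.\<close>
  moreover have "{f y, w} \<notin> C" using w(2) unfolding C_eq induced_edges_def by blast
  ultimately show thesis using that[of "{f y, w}"] w(3) by simp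
qed

text \<open>The edges of one move face a fixed red set \<open>D\<close>, so leaves can be added one
  at a time. The bound on \<open>N\<close> is what the last of the \<open>j\<close> extensions
  requires.\<close>

lemma blue_subtree_extend_many:
  assumes T: "is_tree T" and C: "blue_subtree T N m C" and m: "0 < m" "m + j \<le> card (verts T)"
    and D: "finite D" "m + j + card D \<le> N"
  shows "\<exists>M. M \<inter> C = {} \<and> M \<inter> D = {} \<and> finite M \<and> card M = j \<and> blue_subtree T N (m + j) (C \<union> M)"
  using m(2) D(2)
proof (induction j)
  case 0
  then show ?case using C by (intro exI[of _ "{}"]) simp
next
  case (Suc j)
  have "m + j \<le> card (verts T)" "m + j + card D \<le> N" using Suc.prems by simp_all
  then obtain M where M: "M \<inter> C = {}" "M \<inter> D = {}" "finite M" "card M = j"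
    "blue_subtree T N (m + j) (C \<union> M)" using Suc.IH by blast
  have "0 < m + j" "m + j < card (verts T)" "m + j + card D < N" using Suc.prems m(1) by simp_all
  then obtain e where e: "e \<notin> C \<union> M" "e \<notin> D" "blue_subtree T N (Suc (m + j)) (insert e (C \<union> M))"
    using blue_subtree_extend[OF T M(5) _ _ D(1)] by metis
  show ?case
  proof (intro exI conjI)
    show "insert e M \<inter> C = {}" "insert e M \<inter> D = {}" "finite (insert e M)" "card (insert e M) = Suc j"
      using M e by simp_all
    show "blue_subtree T N (m + Suc j) (C \<union> insert e M)" using e(3) by simp
  qed
qed

section \<open>Moves and plays\<close>

text \<open>A move must have a prescribed size, so a useful but too small set of edges is padded
  with arbitrary uncolored ones.\<close>

lemma legal_move_extends:
  assumes "M \<subseteq> edges (complete_graph N) - X" "card M \<le> k"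
  obtains M' where "legal_move N k X M'" "M \<subseteq> M'"
proof -
  let ?U = "edges (complete_graph N) - X"
  have fin: "finite ?U" using finite_edges_complete_graph by blast
  then have "card M \<le> min k (card ?U)" using assms card_mono by auto
  then obtain M' where "M \<subseteq> M'" "M' \<subseteq> ?U" "card M' = min k (card ?U)"
    using exists_subset_between[OF _ _ assms(1) fin, of "min k (card ?U)"] by auto
  then show thesis using that by (simp add: legal_move_def)
qed

lemma legal_move_exists: "\<exists>M. legal_move N k X M"
  using legal_move_extends[of "{}" N X k] by auto

lemma colored_before_Suc: "colored_before M (Suc t) = colored_before M t \<union> M t"
  by (auto simp: colored_before_def lessThan_Suc)

text \<open>Rules out that a strategy wins vacuously: Bob can always reply legally, even if
  \<open>\<sigma>\<close> makes illegal moves.\<close>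

lemma bob_legal_play_exists: "\<exists>A B. follows \<sigma> A B \<and> bob_legal q N A B"
proof -
  define reply where "reply h = (SOME M. legal_move N q
    (\<Union>(fst ` set h) \<union> \<sigma> h \<union> \<Union>(snd ` set h)) M)" for h
  \<comment> \<open>The moves of both players depend on each other through the past, so the history
    is built by recursion and the moves are read off from it.\<close>
  define hist where "hist = rec_nat [] (\<lambda>_ h. h @ [(\<sigma> h, reply h)])"
  define A where "A t = \<sigma> (hist t)" for t
  define B where "B t = reply (hist t)" for t
  have hist: "hist t = map (\<lambda>s. (A s, B s)) [0..<t]" for t
    by (induction t) (auto simp: hist_def A_def B_def)
  have "follows \<sigma> A B" unfolding follows_def hist[symmetric] by (simp add: A_def)
  moreover have "legal_move N q (colored_before A (Suc t) \<union> colored_before B t) (B t)" for t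
  proof -
    have "colored_before A (Suc t) = \<Union>(fst ` set (hist t)) \<union> \<sigma> (hist t)"
      by (simp add: colored_before_Suc A_def[of t]) (simp add: hist colored_before_def image_image lessThan_atLeast0)
    moreover have "colored_before B t = \<Union>(snd ` set (hist t))"
      by (simp add: colored_before_def hist image_image lessThan_atLeast0)
    ultimately show ?thesis
      unfolding B_def reply_def by (simp add: someI_ex[OF legal_move_exists])
  qed
  ultimately show ?thesis unfolding bob_legal_def by blast
qed

section \<open>The lower bound\<close>

lemma winning_strategy_card_le:
  assumes "winning_strategy p q G N \<sigma>"
  shows "card (verts G) \<le> N"
proof -
  obtain A B where "follows \<sigma> A B" "bob_legal q N A B" using bob_legal_play_exists by blast
  then have "alice_wins G N A B" using assms by (auto simp: winning_strategy_def)
  then show ?thesis using has_copy_card_verts by (auto simp: alice_wins_def)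
qed

section \<open>From an invariant to the upper bound\<close>

lemma bob_legal_colored_before:
  assumes "bob_legal q N A B"
  shows "colored_before B t \<subseteq> edges (complete_graph N)" "card (colored_before B t) \<le> q * t"
proof -
  have B: "B s \<subseteq> edges (complete_graph N)" "card (B s) \<le> q" for s
    using assms by (auto simp: bob_legal_def legal_move_def)
  then show "colored_before B t \<subseteq> edges (complete_graph N)" by (auto simp: colored_before_def)
  show "card (colored_before B t) \<le> q * t"
  proof (induction t)
    case (Suc t)
    then show ?case
      using card_Un_le[of "colored_before B t" "B t"] B(2)[of t]
      by (simp add: colored_before_Suc)
  qed (simp add: colored_before_def)
qed

text \<open>Reduces the game to single moves: \<open>I t C\<close> describes Alice's edges at the
  start of round \<open>t\<close>, and of Bob's edges only the number is used. The step is required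
  after round \<open>k\<close> as well, because Alice's moves must stay legal forever.\<close>

lemma winning_strategy_from_invariant:
  assumes init: "I 0 {}"
    and step: "\<And>t C D. \<lbrakk>I t C; D \<subseteq> edges (complete_graph N); card D \<le> q * t\<rbrakk>
      \<Longrightarrow> \<exists>M. legal_move N p (C \<union> D) M \<and> I (Suc t) (C \<union> M)"
    and final: "\<And>C. I (Suc k) C \<Longrightarrow> has_copy G N C"
    and bob: "\<And>D. \<lbrakk>D \<subseteq> edges (complete_graph N); card D \<le> q * k\<rbrakk> \<Longrightarrow> \<not> has_copy G N D"
  shows "\<exists>\<sigma>. winning_strategy p q G N \<sigma>"
proof -
  define move where "move t C D = (SOME M. legal_move N p (C \<union> D) M \<and> I (Suc t) (C \<union> M))" for t C D
  define \<sigma> where "\<sigma> h = move (length h) (\<Union>(fst ` set h)) (\<Union>(snd ` set h))" for h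
  have "alice_legal p N A B \<and> alice_wins G N A B" if fo: "follows \<sigma> A B" and bl: "bob_legal q N A B"
    for A B
  proof -
    have A: "A t = move t (colored_before A t) (colored_before B t)" for t
    proof -
      have "A t = \<sigma> (map (\<lambda>s. (A s, B s)) [0..<t])" using fo unfolding follows_def ..
      also have "\<dots> = move t (colored_before A t) (colored_before B t)"
        by (simp add: \<sigma>_def image_image colored_before_def lessThan_atLeast0)
      finally show ?thesis .
    qed
    note D = bob_legal_colored_before[OF bl]
    have *: "legal_move N p (colored_before A t \<union> colored_before B t) (A t) \<and>
        I (Suc t) (colored_before A t \<union> A t)" if "I t (colored_before A t)" for t
      using someI_ex[OF step[OF that D[of t]]] unfolding A[of t] move_def .
    have inv: "I t (colored_before A t)" for t
    proof (induction t)
      case 0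
      show ?case using init by (simp add: colored_before_def)
    next
      case (Suc t)
      show ?case using *[OF Suc] unfolding colored_before_Suc by (rule conjunct2)
    qed
    have "alice_legal p N A B" unfolding alice_legal_def using *[OF inv] by blast
    \<comment> \<open>Round \<open>k\<close> is the witness: Alice's edges include her move in it,
      Bob's only those of earlier rounds.\<close>
    moreover have "alice_wins G N A B"
      unfolding alice_wins_def using final[OF inv] bob[OF D] by (intro exI[of _ k] conjI)
    ultimately show ?thesis ..
  qed
  then show ?thesis unfolding winning_strategy_def by blast
qed

lemma tree_winning_strategy:
  assumes p: "p \<ge> q" "p \<ge> 1" and T: "is_tree T" and n: "card (verts T) = n" "n \<ge> 2"
  shows "\<exists>\<sigma>. winning_strategy p q T (n + q * ((n - 2) div p)) \<sigma>"
proof -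
  define k where "k = (n - 2) div p"
  define N where "N = n + q * k"
  \<comment> \<open>One starting vertex and \<open>p\<close> new leaves per round give
    \<open>Suc (p * t)\<close>. After round \<open>k\<close> only a copy is claimed, since padding
    may spoil the exact shape.\<close>
  define I where "I t C \<longleftrightarrow> (if t \<le> k then blue_subtree T N (Suc (p * t)) C else has_copy T N C)"
    for t C
  have E: "edges T \<subseteq> [verts T]\<^bsup>2\<^esup>" and con: "connected_graph T"
    using T by (auto simp: is_tree_def finite_simple_graph_def)
  \<comment> \<open>After \<open>k\<close> full moves the subtree has \<open>p * k + 1\<close>
    vertices, still fewer than \<open>n\<close>, and by the next bound one more move
    suffices.\<close>
  have pk: "p * k \<le> n - 2" by (simp add: k_def)
  have pk': "n - 2 < p * k + p"
    using p(2) dividend_less_div_times[of p "n - 2"] by (simp add: k_def mult.commute add.commute)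
  have fin: "finite D" if "D \<subseteq> edges (complete_graph N)" for D
    using that finite_edges_complete_graph finite_subset by blast
  have "\<exists>\<sigma>. winning_strategy p q T N \<sigma>"
  proof (rule winning_strategy_from_invariant[where I = I and k = k])
    obtain v where v: "v \<in> verts T" using con by (auto simp: connected_graph_def)
    then have "blue_subtree T N 1 {}"
      unfolding blue_subtree_def using path_connected_singleton[OF v] n(2)
      by (intro exI[of _ "{v}"] exI[of _ "\<lambda>_. 0"]) (simp add: induced_edges_singleton[OF E] N_def)
    then show "I 0 {}" by (simp add: I_def)
  next
    fix t C D
    assume inv: "I t C" and D: "D \<subseteq> edges (complete_graph N)" "card D \<le> q * t"
    show "\<exists>M. legal_move N p (C \<union> D) M \<and> I (Suc t) (C \<union> M)"
    proof (cases "t \<le> k")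
      \<comment> \<open>The copy is already there and survives, so any legal move will do.\<close>
      case False
      then have "I (Suc t) (C \<union> M)" for M
        using inv has_copy_mono[of T N C "C \<union> M"] by (simp add: I_def)
      then show ?thesis using legal_move_exists by blast
    next
      case True
      \<comment> \<open>The number of useful edges: \<open>p\<close> before round \<open>k\<close>,
        and all the missing ones in round \<open>k\<close>.\<close>
      define j where "j = min p (n - Suc (p * t))"
      have "p * t \<le> p * k" "q * t \<le> q * k" using True by auto
      moreover from this have le: "Suc (p * t) + j \<le> n"
        using pk n(2) unfolding j_def by linarith
      \<comment> \<open>In \<open>N\<close>, the summand \<open>n\<close> makes room for the copy
        and \<open>q * k\<close> for the vertices blocked by red edges.\<close>
      ultimately have le2: "Suc (p * t) + j + card D \<le> N"
        using D(2) unfolding N_def by linarith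
      obtain M where M: "M \<inter> C = {}" "M \<inter> D = {}" "card M = j"
        "blue_subtree T N (Suc (p * t) + j) (C \<union> M)"
        using blue_subtree_extend_many[OF T _ _ _ fin[OF D(1)] le2, of C] inv True le n(1)
        unfolding I_def by auto
      have "M \<subseteq> edges (complete_graph N) - (C \<union> D)"
        using M(1,2) blue_subtree_subset[OF T M(4)] by blast
      then obtain M' where M': "legal_move N p (C \<union> D) M'" "M \<subseteq> M'"
        using legal_move_extends[of M N "C \<union> D" p] M(3) by (auto simp: j_def)
      have "I (Suc t) (C \<union> M')"
      proof (cases "t = k")
        case True
        then have "Suc (p * t) + j = card (verts T)" using pk pk' n by (simp add: j_def)
        then have "has_copy T N (C \<union> M)" using blue_subtree_has_copy[OF T] M(4) by simp
        then have "has_copy T N (C \<union> M')" by (rule has_copy_mono) (use M'(2) in blast)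
        then show ?thesis using True by (simp add: I_def)
      next
        case False
        \<comment> \<open>Before round \<open>k\<close> all \<open>p\<close> edges are useful, so
          padding adds nothing and the blue edges keep the exact shape demanded by
          \<open>blue_subtree\<close>.\<close>
        then have "Suc t \<le> k" using \<open>t \<le> k\<close> by simp
        then have "p * Suc t \<le> p * k" by (rule mult_le_mono2)
        then have "j = p" using pk n(2) by (simp add: j_def)
        moreover have "finite M'"
          using M'(1) finite_edges_complete_graph finite_subset unfolding legal_move_def by blast
        moreover have "card M' \<le> p" using M'(1) by (simp add: legal_move_def)
        ultimately have "M = M'" using M(3) M'(2) by (intro card_seteq) auto
        then show ?thesis using M(4) \<open>j = p\<close> \<open>Suc t \<le> k\<close> by (simp add: I_def add.commute)
      qed
      then show ?thesis using M'(1) by blast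
    qed
  next
    show "has_copy T N C" if "I (Suc k) C" for C using that by (simp add: I_def)
  next
    fix D assume D: "D \<subseteq> edges (complete_graph N)" "card D \<le> q * k"
    show "\<not> has_copy T N D"
    proof
      assume "has_copy T N D"
      then have "card (edges T) \<le> card D" using has_copy_card_edges E fin[OF D(1)] by blast
      \<comment> \<open>Here \<open>q \<le> p\<close> enters: Bob has at most
        \<open>p * k \<le> n - 2\<close> edges, while a copy needs \<open>n - 1\<close>.\<close>
      moreover have "q * k \<le> p * k" using p(1) by simp
      ultimately show False using D(2) pk card_edges_tree[OF T] n by linarith
    qed
  qed
  then show ?thesis by (simp add: N_def k_def)
qed

theorem theorem1:
  fixes p q n :: nat and T :: "'a ugraph"
  assumes "q \<ge> 1" and "p \<ge> q"
    and "is_tree T" and "card (verts T) = n" and "n \<ge> 2"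
  shows "enat n \<le> achievement_number p q T \<and>
         achievement_number p q T \<le> enat (n + q * ((n - 2) div p))"
proof
  \<comment> \<open>Every \<open>N\<close> in the set over which the infimum is taken is at least
    \<open>n\<close>, because a winning play contains a copy of \<open>T\<close> inside the complete
    graph.\<close>
  show "enat n \<le> achievement_number p q T"
    unfolding achievement_number_def
    using winning_strategy_card_le assms(4) by (fastforce intro!: Inf_greatest)
  have "\<exists>\<sigma>. winning_strategy p q T (n + q * ((n - 2) div p)) \<sigma>"
    using tree_winning_strategy[OF assms(2) _ assms(3-5)] assms(1,2) by simp
  then show "achievement_number p q T \<le> enat (n + q * ((n - 2) div p))"
    unfolding achievement_number_def by (intro Inf_lower) blast
qed

end
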